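(* Let $\Psi_1=\left\langle\begin{pmatrix} 1 & 1\\ 0 & 1\end{pmatrix},\begin{pmatrix} 1 & 0\\ 4 & 1\end{pmatrix}\right\rangle^+$ and $\Psi_2=\left\langle\begin{pmatrix} 1 & 4\\ 0 & 1\end{pmatrix},\begin{pmatrix} 1 & 0\\ 4 & 1\end{pmatrix}\right\rangle^+$. Numerators in the orbit $\Psi_1\begin{pmatrix} 2\\ 3\end{pmatrix}$ have no congruence obstructions, yet cannot be square. Denominators in the orbit $\Psi_2\begin{pmatrix} 3\\ 8\end{pmatrix}$ are only restricted to be $0\pmod{4}$, yet cannot be square. In particular, these are both instances of reciprocity obstructions.
   Context: $\langle A_1,A_2,\ldots\rangle^+$ denotes the monoid multiplicatively generated by the $A_i$ together with the identity. For $\begin{pmatrix} u\\ v\end{pmatrix}$ in an orbit $\Gamma\begin{pmatrix} x\\ y\end{pmatrix}$, $u$ is the numerator and $v$ the denominator. An orbit exhibits a congruence obstruction modulo $n$ if the residues modulo $n$ of its numerators (resp. denominators) are not all residues modulo $n$. A reciprocity obstruction means the numerators (resp. denominators) include squares modulo every $n\ge1$ but contain no integer squares. *)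

theory Defs
  imports
    "HOL-Analysis.Analysis"
    "HOL-Number_Theory.Cong"
    "HOL-Computational_Algebra.Nth_Powers"
begin

inductive_set generated_monoid :: "(int ^ 2 ^ 2) set \<Rightarrow> (int ^ 2 ^ 2) set"
  for S :: "(int ^ 2 ^ 2) set" where
  one: "mat 1 \<in> generated_monoid S"
| gen: "A \<in> S \<Longrightarrow> A \<in> generated_monoid S"
| mult: "A \<in> generated_monoid S \<Longrightarrow> B \<in> generated_monoid S \<Longrightarrow> A ** B \<in> generated_monoid S"

definition Psi1 :: "(int ^ 2 ^ 2) set" where
  "Psi1 = generated_monoid
     {vector [vector [1, 1], vector [0, 1]], vector [vector [1, 0], vector [4, 1]]}"

definition Psi2 :: "(int ^ 2 ^ 2) set" where
  "Psi2 = generated_monoid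
     {vector [vector [1, 4], vector [0, 1]], vector [vector [1, 0], vector [4, 1]]}"

definition orbit :: "(int ^ 2 ^ 2) set \<Rightarrow> int ^ 2 \<Rightarrow> (int ^ 2) set" where
  "orbit \<Gamma> w = (\<lambda>A. A *v w) ` \<Gamma>"

definition numerators :: "(int ^ 2) set \<Rightarrow> int set" where
  "numerators X = (\<lambda>w. w $ 1) ` X"

definition denominators :: "(int ^ 2) set \<Rightarrow> int set" where
  "denominators X = (\<lambda>w. w $ 2) ` X"

text \<open>The following notions are meant for the set of numerators or the set of denominators
  of an orbit.\<close>

definition residues_mod :: "int \<Rightarrow> int set \<Rightarrow> int set" where
  "residues_mod n S = (\<lambda>s. s mod n) ` S"

definition congruence_obstruction :: "int \<Rightarrow> int set \<Rightarrow> bool" where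
  "congruence_obstruction n S \<longleftrightarrow> residues_mod n S \<noteq> {0..<n}"

definition reciprocity_obstruction :: "int set \<Rightarrow> bool" where
  "reciprocity_obstruction S \<longleftrightarrow>
     (\<forall>n\<ge>1. \<exists>s\<in>S. \<exists>k. [s = k\<^sup>2] (mod n)) \<and> \<not> (\<exists>s\<in>S. is_square s)"

text \<open>\<open>S\<close> is subject to the congruence \<open>a (mod m)\<close> and to no other congruence restriction:
  modulo every \<open>n\<close> it meets each residue class that the progression \<open>a + m\<int>\<close> meets.\<close>

definition only_restricted_to :: "int \<Rightarrow> int \<Rightarrow> int set \<Rightarrow> bool" where
  "only_restricted_to a m S \<longleftrightarrow>
     (\<forall>s\<in>S. [s = a] (mod m)) \<and>
     (\<forall>n\<ge>1. residues_mod n S = residues_mod n {t. [t = a] (mod m)})"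

end

theory Submission
  imports Defs
begin

text \<open>
  Both semigroups preserve a Jacobi symbol: for odd positive \<open>n\<close> coprime to \<open>a > 0\<close>, the symbol
  \<open>(a/n)\<close> depends only on \<open>a\<close> modulo \<open>n\<close>, and only on \<open>n\<close> modulo \<open>4a\<close>. It equals \<open>-1\<close> at both
  base points, hence on the whole orbits, whereas it is \<open>1\<close> if \<open>a\<close> is a square.

  The symbol is taken in the form of Gauss' lemma, as a product of signs over the half system
  \<open>1, \<dots>, (n - 1)/2\<close>. Multiplication by a unit permutes the half system up to sign, which makes the
  symbol multiplicative, and a count of lattice points shows the dependence on \<open>n\<close> modulo \<open>4a\<close>;
  neither a factorisation of \<open>n\<close> nor quadratic reciprocity is needed.

  That there are no further congruence restrictions is already seen on elements of the form
  \<open>U\<^sup>m V\<^sup>j w\<close>, where \<open>j\<close> is chosen such that the step width of the progression in \<open>m\<close> is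
  invertible modulo the given modulus.
\<close>

section \<open>The Jacobi symbol by Gauss' lemma\<close>

text \<open>For odd positive \<open>n\<close> this is the sign of the representative of
  \<open>x\<close> of least absolute value; multiples of \<open>n\<close> get the value 1.\<close>

definition residue_sign :: "int \<Rightarrow> int \<Rightarrow> int" where
  "residue_sign n x = (if 2 * (x mod n) < n then 1 else -1)"

definition jacobi :: "int \<Rightarrow> int \<Rightarrow> int" where
  "jacobi a n = (\<Prod>k\<in>{1..(n - 1) div 2}. residue_sign n (a * k))"

lemma residue_sign_cong: "x mod n = y mod n \<Longrightarrow> residue_sign n x = residue_sign n y"
  by (simp add: residue_sign_def)

lemma residue_sign_square [simp]: "residue_sign n x * residue_sign n x = 1"
  by (simp add: residue_sign_def)

lemma residue_sign_cases: "residue_sign n x = 1 \<or> residue_sign n x = -1"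
  by (simp add: residue_sign_def)

lemma residue_sign_uminus:
  assumes "odd n" "n > 0" "\<not> n dvd x"
  shows "residue_sign n (- x) = - residue_sign n x"
proof -
  have "(- x) mod n = n - x mod n"
    using assms by (simp add: zmod_zminus1_eq_if dvd_eq_mod_eq_0)
  moreover have "2 * (x mod n) \<noteq> n"
    using assms(1) by (metis dvd_triv_left)
  ultimately show ?thesis
    by (auto simp: residue_sign_def)
qed

section \<open>Action of units on the half system, and multiplicativity\<close>

lemma half_system_not_dvd:
  fixes a n k :: int
  assumes "coprime a n" "k \<in> {1..(n - 1) div 2}"
  shows "\<not> n dvd a * k"
proof
  assume "n dvd a * k"
  then have "n dvd k"
    using assms(1) by (simp add: coprime_commute coprime_dvd_mult_right_iff)
  then have "n \<le> k"
    using assms(2) by (auto intro: zdvd_imp_le)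
  then show False
    using assms(2) by auto
qed

text \<open>For odd positive \<open>n\<close>, the absolute value of the least absolute residue of
  \<open>x\<close>.\<close>

definition absolute_residue :: "int \<Rightarrow> int \<Rightarrow> int" where
  "absolute_residue n x = (residue_sign n x * x) mod n"

lemma absolute_residue_in_half_system:
  assumes "odd n" "n > 0" "\<not> n dvd x"
  shows "absolute_residue n x \<in> {1..(n - 1) div 2}"
proof -
  have neg: "(- x) mod n = n - x mod n"
    using assms by (simp add: zmod_zminus1_eq_if dvd_eq_mod_eq_0)
  have pos: "0 < x mod n" "x mod n < n"
    using assms pos_mod_bound[of n x] pos_mod_sign[of n x] by (auto simp: dvd_eq_mod_eq_0 order_less_le)
  obtain m where "n = 2 * m + 1"
    using assms(1) by (elim oddE)
  then show ?thesis
    using neg pos by (auto simp: absolute_residue_def residue_sign_def)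
qed

text \<open>If \<open>k\<close> and \<open>l\<close> have the same image, cancelling
  \<open>a\<close> shows that \<open>n\<close> divides \<open>k - l\<close> or \<open>k + l\<close>.
  Both are smaller than \<open>n\<close> in absolute value and \<open>k + l\<close> is positive, so
  \<open>k = l\<close>; an injective self-map of a finite set is bijective.\<close>

lemma bij_betw_absolute_residue:
  assumes "odd n" "n > 0" "coprime a n"
  shows "bij_betw (\<lambda>k. absolute_residue n (a * k)) {1..(n - 1) div 2} {1..(n - 1) div 2}"
    (is "bij_betw ?f ?H ?H")
proof -
  have inj: "inj_on ?f ?H"
  proof (rule inj_onI)
    fix k l assume k: "k \<in> ?H" and l: "l \<in> ?H" and eq: "?f k = ?f l"
    have "n dvd residue_sign n (a * k) * (a * k) - residue_sign n (a * l) * (a * l)"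
      using eq by (simp add: absolute_residue_def mod_eq_dvd_iff)
    also have "\<dots> = a * (residue_sign n (a * k) * k - residue_sign n (a * l) * l)"
      by (simp add: algebra_simps)
    finally have d: "n dvd residue_sign n (a * k) * k - residue_sign n (a * l) * l"
      using assms(3) by (simp add: coprime_commute coprime_dvd_mult_right_iff)
    have "residue_sign n (a * k) * k - residue_sign n (a * l) * l \<in> {k - l, k + l, - (k + l), - (k - l)}"
      using residue_sign_cases[of n "a * k"] residue_sign_cases[of n "a * l"] by auto
    with d have "n dvd k - l \<or> n dvd k + l"
      by (metis dvd_minus_iff empty_iff insert_iff)
    moreover have "\<not> n dvd k + l"
      using k l zdvd_imp_le[of n "k + l"] by auto
    moreover have "k = l" if "n dvd k - l"
      using k l that zdvd_imp_le[of n "k - l"] zdvd_imp_le[of n "l - k"]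
      by (cases k l rule: linorder_cases) (auto simp: dvd_diff_commute)
    ultimately show "k = l"
      by simp
  qed
  moreover have "?f ` ?H \<subseteq> ?H"
    using absolute_residue_in_half_system half_system_not_dvd assms by blast
  ultimately show ?thesis
    by (simp add: bij_betw_def endo_inj_surj)
qed

text \<open>Modulo \<open>n\<close>, \<open>b * k\<close> is a sign times the half-system element
  \<open>?f k\<close>. The signs multiply to \<open>jacobi b n\<close>; as \<open>?f\<close>
  permutes the half system, the remaining factors multiply to \<open>jacobi a n\<close>.\<close>

lemma jacobi_mult:
  assumes "odd n" "n > 0" "coprime a n" "coprime b n"
  shows "jacobi (a * b) n = jacobi a n * jacobi b n"
proof -
  let ?H = "{1..(n - 1) div 2}"
  let ?f = "\<lambda>k. absolute_residue n (b * k)"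
  have "residue_sign n (a * b * k) = residue_sign n (a * ?f k) * residue_sign n (b * k)"
    if k: "k \<in> ?H" for k
  proof -
    have fk: "?f k \<in> ?H"
      using absolute_residue_in_half_system half_system_not_dvd assms k by blast
    have nd: "\<not> n dvd a * ?f k"
      by (rule half_system_not_dvd[OF assms(3) fk])
    have "(a * ?f k) mod n = (residue_sign n (b * k) * (a * b * k)) mod n"
      by (simp add: absolute_residue_def mod_mult_right_eq mult_ac)
    then have "(residue_sign n (b * k) * (a * ?f k)) mod n
        = (residue_sign n (b * k) * residue_sign n (b * k) * (a * b * k)) mod n"
      by (metis mod_mult_right_eq mult.assoc)
    then have "residue_sign n (a * b * k) = residue_sign n (residue_sign n (b * k) * (a * ?f k))"
      by (intro residue_sign_cong) simp
    \<comment> \<open>Off the multiples of \<open>n\<close>, \<open>residue_sign n\<close> is an odd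
      function, so the sign can be pulled out.\<close>
    also have "\<dots> = residue_sign n (a * ?f k) * residue_sign n (b * k)"
      using residue_sign_cases[of n "b * k"] residue_sign_uminus[OF assms(1,2) nd] by auto
    finally show ?thesis .
  qed
  then have "jacobi (a * b) n = (\<Prod>k\<in>?H. residue_sign n (a * ?f k)) * jacobi b n"
    by (simp add: jacobi_def prod.distrib)
  also have "(\<Prod>k\<in>?H. residue_sign n (a * ?f k)) = jacobi a n"
    unfolding jacobi_def
    by (rule prod.reindex_bij_betw[OF bij_betw_absolute_residue[OF assms(1,2,4)]])
  finally show ?thesis .
qed

lemma jacobi_square:
  assumes "odd n" "n > 0" "coprime a n"
  shows "jacobi (a\<^sup>2) n = 1"
proof -
  have "jacobi (a\<^sup>2) n = jacobi a n * jacobi a n"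
    using jacobi_mult[OF assms(1,2,3,3)] by (simp add: power2_eq_square)
  also have "\<dots> = 1"
    by (simp add: jacobi_def flip: prod.distrib)
  finally show ?thesis .
qed

lemma jacobi_add_mult_left: "jacobi (a + m * n) n = jacobi a n"
  unfolding jacobi_def
proof (intro prod.cong refl residue_sign_cong)
  fix k
  have "(a + m * n) * k = a * k + n * (m * k)"
    by (simp add: algebra_simps)
  then show "(a + m * n) * k mod n = a * k mod n"
    by simp
qed

section \<open>Periodicity in the lower argument by counting lattice points\<close>

lemma residue_sign_eq_power:
  assumes "n > 0" "x \<ge> 0"
  shows "residue_sign n x = (-1) ^ nat ((2 * x) div n)"
proof -
  define q r where "q = x div n" and "r = x mod n"
  have x: "x = q * n + r" and r: "0 \<le> r" "r < n" and q: "q \<ge> 0"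
    using assms by (auto simp: q_def r_def pos_imp_zdiv_nonneg_iff)
  have "2 * x = 2 * r + (2 * q) * n"
    using x by simp
  then have d: "(2 * x) div n = 2 * q + (2 * r) div n"
    using assms(1) by (metis add.commute div_mult_self1 less_irrefl)
  have "(2 * r) div n = (if 2 * r < n then 0 else 1)"
    using r int_div_pos_eq[of "2 * r" n 1 "2 * r - n"] by auto
  then have "nat ((2 * x) div n) = 2 * nat q + (if 2 * r < n then 0 else 1)"
    using d q by auto
  then show ?thesis
    by (simp add: residue_sign_def r_def)
qed

text \<open>The lattice points \<open>(k, j)\<close> at fixed height \<open>j\<close>, with
  \<open>k\<close> in the half system, on or below the line of slope \<open>2 * a / n\<close>
  through the origin.\<close>

definition lattice_column :: "int \<Rightarrow> int \<Rightarrow> int \<Rightarrow> int set" where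
  "lattice_column a n j = {k \<in> {1..(n - 1) div 2}. n * j \<le> 2 * a * k}"

text \<open>The exponent \<open>(2 * (a * k)) div n\<close> counts the lattice points above
  \<open>k\<close> up to the line; summing over \<open>k\<close> and exchanging the sums counts them
  by height.\<close>

lemma jacobi_eq_lattice_count:
  assumes "n > 0" "a > 0"
  shows "jacobi a n = (-1) ^ (\<Sum>j\<in>{1..a}. card (lattice_column a n j))"
proof -
  let ?H = "{1..(n - 1) div 2}"
  have row: "nat ((2 * (a * k)) div n) = card {j \<in> {1..a}. n * j \<le> 2 * a * k}" if k: "k \<in> ?H" for k
  proof -
    \<comment> \<open>Since \<open>2 * k < n\<close>, restricting \<open>j\<close> to
      \<open>{1..a}\<close> loses no points.\<close>
    have "2 * a * k \<le> a * n"
      using k assms by (auto simp: mult.assoc mult.left_commute[of 2])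
    then have le: "j \<le> a" if "n * j \<le> 2 * a * k" for j
      using that assms by (metis mult.commute mult_le_cancel_right_pos order_trans)
    have iff: "n * j \<le> 2 * a * k \<longleftrightarrow> j \<le> (2 * a * k) div n" for j
    proof
      assume "n * j \<le> 2 * a * k"
      then show "j \<le> (2 * a * k) div n"
        using zdiv_mono1[of "n * j" "2 * a * k" n] assms(1) by simp
    next
      assume "j \<le> (2 * a * k) div n"
      then have "n * j \<le> n * ((2 * a * k) div n)"
        using assms(1) by simp
      also have "\<dots> \<le> 2 * a * k"
        using mult_div_mod_eq[of n "2 * a * k"] pos_mod_sign[OF assms(1), of "2 * a * k"] by linarith
      finally show "n * j \<le> 2 * a * k" .
    qed
    have "j \<in> {j \<in> {1..a}. n * j \<le> 2 * a * k} \<longleftrightarrow> j \<in> {1..(2 * a * k) div n}" for j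
      using le[of j] iff[of j] by auto
    then have "{j \<in> {1..a}. n * j \<le> 2 * a * k} = {1..(2 * a * k) div n}"
      by blast
    then show ?thesis
      by (simp add: mult.assoc)
  qed
  have "jacobi a n = (\<Prod>k\<in>?H. (-1) ^ nat ((2 * (a * k)) div n))"
    unfolding jacobi_def using assms by (intro prod.cong refl residue_sign_eq_power) auto
  also have "\<dots> = (-1) ^ (\<Sum>k\<in>?H. nat ((2 * (a * k)) div n))"
    by (simp add: power_sum)
  also have "(\<Sum>k\<in>?H. nat ((2 * (a * k)) div n)) =
      (\<Sum>k\<in>?H. \<Sum>j | j \<in> {1..a} \<and> n * j \<le> 2 * a * k. 1)"
    by (intro sum.cong refl) (simp add: row)
  also have "\<dots> = (\<Sum>j\<in>{1..a}. \<Sum>k | k \<in> ?H \<and> n * j \<le> 2 * a * k. 1)"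
    by (rule sum.swap_restrict) auto
  finally show ?thesis
    by (simp add: lattice_column_def)
qed

text \<open>Translating \<open>k\<close> by \<open>2 * j\<close> turns the inequality for
  \<open>n + 4 * a\<close> into that for \<open>n\<close>. The half system grows by
  \<open>2 * a\<close> but the shift uses only \<open>2 * j\<close>, leaving the
  \<open>2 * (a - j)\<close> extra points of \<open>?T\<close>. What matters later is that this
  number is even.\<close>

lemma card_lattice_column_shift:
  assumes "odd n" "n > 0" "a > 0" "j \<in> {1..a}"
  shows "card (lattice_column a (n + 4 * a) j) = card (lattice_column a n j) + 2 * nat (a - j)"
proof -
  obtain m where n: "n = 2 * m + 1"
    using assms(1) by (elim oddE)
  let ?T = "{m + 1..m + 2 * (a - j)}"
  have above: "n * j \<le> 2 * a * k" if "k \<ge> m + 1" for k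
  proof -
    have "n * j \<le> n * a"
      using assms by simp
    also have "\<dots> \<le> (2 * k) * a"
      using that n assms(3) by (intro mult_right_mono) auto
    finally show ?thesis
      by (simp add: mult_ac)
  qed
  \<comment> \<open>The inequality itself forces the lower bound, so the translation needs no
    correction at the lower end.\<close>
  have below: "k \<ge> 1" if "n * j \<le> 2 * a * k" for k
  proof -
    have "0 < n * j"
      using assms by simp
    then have "0 < 2 * a * k"
      using that by linarith
    then show ?thesis
      using assms(3) by (simp add: zero_less_mult_iff)
  qed
  have "k \<in> lattice_column a (n + 4 * a) j \<longleftrightarrow> k - 2 * j \<in> lattice_column a n j \<union> ?T" for k
  proof -
    have "(n + 4 * a) * j \<le> 2 * a * k \<longleftrightarrow> n * j \<le> 2 * a * (k - 2 * j)"
      by (simp add: algebra_simps)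
    moreover have "(n - 1) div 2 = m" "(n + 4 * a - 1) div 2 = m + 2 * a"
      using n by auto
    ultimately show ?thesis
      using above[of "k - 2 * j"] below[of "k - 2 * j"] assms(2,4) n
      by (simp add: lattice_column_def) linarith
  qed
  then have "lattice_column a (n + 4 * a) j = {k. k - 2 * j \<in> lattice_column a n j \<union> ?T}"
    by blast
  also have "\<dots> = (\<lambda>k. k + 2 * j) ` (lattice_column a n j \<union> ?T)"
  proof (intro set_eqI)
    fix k
    show "k \<in> {k. k - 2 * j \<in> lattice_column a n j \<union> ?T} \<longleftrightarrow>
        k \<in> (\<lambda>k. k + 2 * j) ` (lattice_column a n j \<union> ?T)"
      unfolding image_iff mem_Collect_eq by (metis add_diff_cancel_right' diff_add_cancel)
  qed
  finally have "lattice_column a (n + 4 * a) j = (\<lambda>k. k + 2 * j) ` (lattice_column a n j \<union> ?T)" .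
  then have "card (lattice_column a (n + 4 * a) j) = card (lattice_column a n j \<union> ?T)"
    by (simp add: card_image)
  also have "\<dots> = card (lattice_column a n j) + card ?T"
  proof (rule card_Un_disjoint)
    show "finite (lattice_column a n j)"
      by (rule finite_subset[of _ "{1..(n - 1) div 2}"]) (auto simp: lattice_column_def)
  qed (auto simp: lattice_column_def n)
  finally show ?thesis
    using assms(4) by (simp add: nat_mult_distrib)
qed

lemma jacobi_add_4_mult_right:
  assumes "odd n" "n > 0" "a > 0"
  shows "jacobi a (n + 4 * a) = jacobi a n"
proof -
  have "(\<Sum>j\<in>{1..a}. card (lattice_column a (n + 4 * a) j)) =
      (\<Sum>j\<in>{1..a}. card (lattice_column a n j)) + 2 * (\<Sum>j\<in>{1..a}. nat (a - j))"
    using card_lattice_column_shift[OF assms] by (simp add: sum.distrib sum_distrib_left)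
  then show ?thesis
    using assms by (simp add: jacobi_eq_lattice_count power_add)
qed

section \<open>Nonresidue pairs\<close>

text \<open>The invariant of both orbits, including the side conditions under which the symbol may
  be manipulated. It is applied to (numerator, denominator) for \<open>Psi1\<close> and to
  (denominator, numerator) for \<open>Psi2\<close>, so that the second entry is odd.\<close>

definition nonresidue_pair :: "int \<Rightarrow> int \<Rightarrow> bool" where
  "nonresidue_pair a n \<longleftrightarrow> a > 0 \<and> n > 0 \<and> odd n \<and> coprime a n \<and> jacobi a n = -1"

lemma nonresidue_pair_not_square:
  assumes "nonresidue_pair a n"
  shows "\<not> is_square a"
proof
  assume "is_square a"
  then obtain k where k: "a = k\<^sup>2"
    by (elim is_nth_powerE) auto
  moreover have "coprime k n"
    using assms k by (simp add: nonresidue_pair_def)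
  ultimately have "jacobi a n = 1"
    using assms jacobi_square[of n k] by (simp add: nonresidue_pair_def)
  then show False
    using assms by (simp add: nonresidue_pair_def)
qed

lemma coprime_add_mult_iff:
  fixes a m n :: int
  shows "coprime (a + m * n) n \<longleftrightarrow> coprime a n"
  using gcd_add_mult[of n m a] by (simp add: coprime_iff_gcd_eq_1 gcd.commute add.commute)

lemma nonresidue_pair_add_left:
  assumes "nonresidue_pair a n" "m \<ge> 0"
  shows "nonresidue_pair (a + m * n) n"
  using assms
  by (auto simp: nonresidue_pair_def jacobi_add_mult_left coprime_add_mult_iff intro: add_pos_nonneg)

lemma nonresidue_pair_add_right:
  assumes "nonresidue_pair a n"
  shows "nonresidue_pair a (n + 4 * a)"
  using assms
  by (auto simp: nonresidue_pair_def jacobi_add_4_mult_right coprime_add_mult_iff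
      coprime_commute[of a])

section \<open>Orbits\<close>

lemma generated_monoid_invariant:
  assumes "A \<in> generated_monoid S" "P w"
    and "\<And>B w. B \<in> S \<Longrightarrow> P w \<Longrightarrow> P (B *v w)"
  shows "P (A *v w)"
  using assms(1,2)
\<comment> \<open>The vector must vary: in a product, the left factor acts on the image under the
  right one.\<close>
proof (induction arbitrary: w rule: generated_monoid.induct)
  case (mult A B)
  then show ?case
    by (metis matrix_vector_mul_assoc)
qed (use assms(3) in auto)

lemma orbit_step:
  assumes "B \<in> S" "w \<in> orbit (generated_monoid S) w0"
  shows "B *v w \<in> orbit (generated_monoid S) w0"
  using assms
  by (auto simp: orbit_def matrix_vector_mul_assoc
      intro!: imageI generated_monoid.mult[OF generated_monoid.gen])

lemma orbit_base: "w \<in> orbit (generated_monoid S) w"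
  unfolding orbit_def by (rule image_eqI[of _ _ "mat 1"]) (auto intro: generated_monoid.one)

lemma vector_2_eq_iff:
  fixes w :: "int ^ 2"
  shows "w = vector [x, y] \<longleftrightarrow> w $ 1 = x \<and> w $ 2 = y"
  by (auto simp: vec_eq_iff forall_2)

lemma upper_mult_vector:
  fixes w :: "int ^ 2"
  shows "(vector [vector [1, c], vector [0, 1]] :: int ^ 2 ^ 2) *v w = vector [w $ 1 + c * w $ 2, w $ 2]"
  by (simp add: vector_2_eq_iff matrix_vector_mult_def sum_2)

lemma lower_mult_vector:
  fixes w :: "int ^ 2"
  shows "(vector [vector [1, 0], vector [c, 1]] :: int ^ 2 ^ 2) *v w = vector [w $ 1, w $ 2 + c * w $ 1]"
  by (simp add: vector_2_eq_iff matrix_vector_mult_def sum_2)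

lemma orbit_upper_power:
  assumes "vector [vector [1, c], vector [0, 1]] \<in> S"
    and "vector [x, y] \<in> orbit (generated_monoid S) w0"
  shows "vector [x + c * int m * y, y] \<in> orbit (generated_monoid S) w0"
proof (induction m)
  case (Suc m)
  then show ?case
    using orbit_step[OF assms(1) Suc] by (simp add: upper_mult_vector algebra_simps)
qed (use assms(2) in simp)

lemma orbit_lower_power:
  assumes "vector [vector [1, 0], vector [c, 1]] \<in> S"
    and "vector [x, y] \<in> orbit (generated_monoid S) w0"
  shows "vector [x, y + c * int m * x] \<in> orbit (generated_monoid S) w0"
proof (induction m)
  case (Suc m)
  then show ?case
    using orbit_step[OF assms(1) Suc] by (simp add: lower_mult_vector algebra_simps)
qed (use assms(2) in simp)

section \<open>Absence of squares in the two orbits\<close>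

lemma Psi1_numerator_not_square:
  assumes "u \<in> numerators (orbit Psi1 (vector [2, 3]))"
  shows "\<not> is_square u"
proof -
  obtain A where A: "A \<in> Psi1" and u: "u = (A *v vector [2, 3]) $ 1"
    using assms by (auto simp: numerators_def orbit_def)
  have "jacobi 2 3 = -1"
    by (simp add: jacobi_def residue_sign_def)
  then have "nonresidue_pair ((vector [2, 3] :: int ^ 2) $ 1) ((vector [2, 3] :: int ^ 2) $ 2)"
    by (simp add: nonresidue_pair_def)
  with A[unfolded Psi1_def] have "nonresidue_pair ((A *v vector [2, 3]) $ 1) ((A *v vector [2, 3]) $ 2)"
    by (rule generated_monoid_invariant)
       \<comment> \<open>The upper generator adds the denominator once to the numerator; the lower
         one adds four times the numerator to the denominator.\<close>
       (use nonresidue_pair_add_left[where m = 1] nonresidue_pair_add_right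
        in \<open>auto simp: upper_mult_vector lower_mult_vector\<close>)
  then show ?thesis
    using u nonresidue_pair_not_square by simp
qed

lemma Psi2_denominator_not_square_and_dvd:
  assumes "v \<in> denominators (orbit Psi2 (vector [3, 8]))"
  shows "\<not> is_square v" "4 dvd v"
proof -
  obtain A where A: "A \<in> Psi2" and v: "v = (A *v vector [3, 8]) $ 2"
    using assms by (auto simp: denominators_def orbit_def)
  have "jacobi 8 3 = -1"
    by (simp add: jacobi_def residue_sign_def)
  moreover have "coprime 8 (3 :: int)"
    using coprime_power_left_iff[of 2 3 "3 :: int"] by simp
  ultimately have "nonresidue_pair ((vector [3, 8] :: int ^ 2) $ 2) ((vector [3, 8] :: int ^ 2) $ 1)"
    by (simp add: nonresidue_pair_def)
  with A[unfolded Psi2_def] have "nonresidue_pair ((A *v vector [3, 8]) $ 2) ((A *v vector [3, 8]) $ 1)"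
    by (rule generated_monoid_invariant)
       \<comment> \<open>With the entries exchanged, the lower generator is the move with
         \<open>m = 4\<close> and the upper one adds four times the first entry to the
         second.\<close>
       (use nonresidue_pair_add_left[where m = 4] nonresidue_pair_add_right
        in \<open>auto simp: upper_mult_vector lower_mult_vector\<close>)
  then show "\<not> is_square v"
    using v nonresidue_pair_not_square by simp
  have "4 dvd (A *v vector [3, 8]) $ 2"
    by (rule generated_monoid_invariant[OF A[unfolded Psi2_def]])
       (auto simp: upper_mult_vector lower_mult_vector)
  then show "4 dvd v"
    using v by simp
qed

section \<open>Residues\<close>

text \<open>Take for \<open>j\<close> the part \<open>y\<close> of \<open>n\<close> prime to
  \<open>p\<close>: then \<open>p + c * y\<close> is coprime to \<open>y\<close> because
  \<open>p\<close> is, and prime to \<open>p\<close> because \<open>p\<close> divides neither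
  \<open>c\<close> nor \<open>y\<close>.\<close>

lemma exists_coprime_in_progression:
  fixes p c n :: int
  assumes "prime p" "\<not> p dvd c" "n \<ge> 1"
  shows "\<exists>j::nat. coprime (p + c * int j) n"
proof -
  have "n \<noteq> 0" "\<not> is_unit p"
    using assms by auto
  then obtain y where y: "n = p ^ multiplicity p n * y" "\<not> p dvd y"
    by (rule multiplicity_decompose')
  have "0 < p ^ multiplicity p n * y"
    using assms(3) y(1) by linarith
  then have "y \<ge> 0"
    using prime_gt_0_int[OF assms(1)] by (simp add: zero_less_mult_iff)
  have "\<not> p dvd p + c * y"
    using assms y(2) by (simp add: prime_dvd_mult_iff)
  then have "coprime (p + c * y) (p ^ multiplicity p n)"
    using assms(1) by (metis coprime_commute coprime_power_right_iff prime_imp_coprime)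
  moreover have "coprime (p + c * y) y"
    using prime_imp_coprime[OF assms(1) y(2)] by (simp add: coprime_add_mult_iff)
  ultimately have "coprime (p + c * y) n"
    by (subst y(1)) simp
  then show ?thesis
    using \<open>y \<ge> 0\<close> by (intro exI[of _ "nat y"]) simp
qed

lemma exists_nat_solution:
  fixes a b n :: int
  assumes "coprime a n" "n \<ge> 1"
  shows "\<exists>m::nat. [int m * a = b] (mod n)"
proof -
  obtain x where "[a * x = 1] (mod n)"
    using assms(1) cong_solve_coprime_int by blast
  then have "[a * x * b = 1 * b] (mod n)"
    by (rule cong_mult) simp
  \<comment> \<open>Reduction modulo \<open>n\<close> makes the multiplier nonnegative, as it will
    serve as an exponent of a generator.\<close>
  then have "[(b * x) mod n * a = b] (mod n)"
    by (simp add: cong_def mod_mult_left_eq mod_mult_right_eq mult_ac)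
  then show ?thesis
    using assms(2) by (intro exI[of _ "nat ((b * x) mod n)"]) simp
qed

lemma Psi1_numerator_cong:
  fixes n t :: int
  assumes "n \<ge> 1"
  shows "\<exists>u\<in>numerators (orbit Psi1 (vector [2, 3])). [u = t] (mod n)"
proof -
  obtain j :: nat where j: "coprime (3 + 8 * int j) n"
    using exists_coprime_in_progression[of 3 8 n] assms by auto
  obtain m :: nat where m: "[int m * (3 + 8 * int j) = t - 2] (mod n)"
    using exists_nat_solution[OF j assms] by blast
  have "vector [2, 3 + 4 * int j * 2] \<in> orbit Psi1 (vector [2, 3])"
    unfolding Psi1_def by (rule orbit_lower_power[OF _ orbit_base]) simp
  then have "vector [2 + 1 * int m * (3 + 4 * int j * 2), 3 + 4 * int j * 2]
      \<in> orbit Psi1 (vector [2, 3])"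
    unfolding Psi1_def by (intro orbit_upper_power) simp_all
  then have "2 + 1 * int m * (3 + 4 * int j * 2) \<in> numerators (orbit Psi1 (vector [2, 3]))"
    unfolding numerators_def by (rule image_eqI[rotated]) simp
  moreover have "[2 + 1 * int m * (3 + 4 * int j * 2) = t] (mod n)"
    using cong_add[OF cong_refl[of 2] m] by (simp add: algebra_simps)
  ultimately show ?thesis
    by blast
qed

lemma Psi2_denominator_cong:
  fixes n t :: int
  assumes "n \<ge> 1" "4 dvd t"
  shows "\<exists>v\<in>denominators (orbit Psi2 (vector [3, 8])). [v = t] (mod n)"
proof -
  obtain s where s: "t = 4 * s"
    using assms(2) by (elim dvdE)
  obtain j :: nat where j: "coprime (3 + 32 * int j) n"
    using exists_coprime_in_progression[of 3 32 n] assms by auto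
  \<comment> \<open>The denominators reached are \<open>8 + 4 * m * (3 + 32 * j)\<close>. Dividing
    the target equation by 4 leaves \<open>3 + 32 * j\<close> as the only factor to invert, so even
    \<open>n\<close> causes no trouble.\<close>
  obtain m :: nat where m: "[int m * (3 + 32 * int j) = s - 2] (mod n)"
    using exists_nat_solution[OF j assms(1)] by blast
  have "vector [3 + 4 * int j * 8, 8] \<in> orbit Psi2 (vector [3, 8])"
    unfolding Psi2_def by (rule orbit_upper_power[OF _ orbit_base]) simp
  then have "vector [3 + 4 * int j * 8, 8 + 4 * int m * (3 + 4 * int j * 8)]
      \<in> orbit Psi2 (vector [3, 8])"
    unfolding Psi2_def by (intro orbit_lower_power) simp_all
  then have "8 + 4 * int m * (3 + 4 * int j * 8) \<in> denominators (orbit Psi2 (vector [3, 8]))"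
    unfolding denominators_def by (rule image_eqI[rotated]) simp
  moreover have "[8 + 4 * int m * (3 + 4 * int j * 8) = t] (mod n)"
    using cong_add[OF cong_refl[of 8] cong_mult[OF cong_refl[of 4] m]]
    by (simp add: s algebra_simps)
  ultimately show ?thesis
    by blast
qed

theorem theorem2p11:
  shows "(\<forall>n\<ge>1. \<not> congruence_obstruction n (numerators (orbit Psi1 (vector [2, 3]))))
    \<and> (\<forall>u \<in> numerators (orbit Psi1 (vector [2, 3])). \<not> is_square u)
    \<and> only_restricted_to 0 4 (denominators (orbit Psi2 (vector [3, 8])))
    \<and> (\<forall>v \<in> denominators (orbit Psi2 (vector [3, 8])). \<not> is_square v)
    \<and> reciprocity_obstruction (numerators (orbit Psi1 (vector [2, 3])))
    \<and> reciprocity_obstruction (denominators (orbit Psi2 (vector [3, 8])))"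
proof (intro conjI)
  let ?N = "numerators (orbit Psi1 (vector [2, 3]))"
  let ?D = "denominators (orbit Psi2 (vector [3, 8]))"
  show "\<forall>n\<ge>1. \<not> congruence_obstruction n ?N"
  proof (intro allI impI)
    fix n :: int assume n: "n \<ge> 1"
    have "r \<in> residues_mod n ?N" if "r \<in> {0..<n}" for r
      using Psi1_numerator_cong[OF n, of r] that
      by (auto simp: residues_mod_def cong_def image_iff intro: sym)
    moreover have "residues_mod n ?N \<subseteq> {0..<n}"
      using n by (auto simp: residues_mod_def)
    ultimately show "\<not> congruence_obstruction n ?N"
      by (auto simp: congruence_obstruction_def)
  qed
  show "\<forall>u\<in>?N. \<not> is_square u"
    using Psi1_numerator_not_square by blast
  show "only_restricted_to 0 4 ?D"
    unfolding only_restricted_to_def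
  proof (intro conjI ballI allI impI equalityI subsetI)
    show dvd: "[v = 0] (mod 4)" if "v \<in> ?D" for v
      using Psi2_denominator_not_square_and_dvd(2)[OF that] by (simp add: cong_0_iff)
    show "r \<in> residues_mod n {t. [t = 0] (mod 4)}" if "r \<in> residues_mod n ?D" for n r
      using that dvd by (auto simp: residues_mod_def)
    show "r \<in> residues_mod n ?D" if n: "n \<ge> 1" and r: "r \<in> residues_mod n {t. [t = 0] (mod 4)}"
      for n r
    proof -
      obtain t where "r = t mod n" "4 dvd t"
        using r by (auto simp: residues_mod_def cong_0_iff)
      then show ?thesis
        using Psi2_denominator_cong[OF n, of t]
        by (auto simp: residues_mod_def cong_def image_iff intro: sym)
    qed
  qed
  show "\<forall>v\<in>?D. \<not> is_square v"
    using Psi2_denominator_not_square_and_dvd(1) by blast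
  \<comment> \<open>In both orbits the residue 0 is attained modulo every \<open>n\<close>, and it
    is a square.\<close>
  show "reciprocity_obstruction ?N"
    unfolding reciprocity_obstruction_def
    using Psi1_numerator_not_square Psi1_numerator_cong[where t = "0\<^sup>2"] by blast
  show "reciprocity_obstruction ?D"
    unfolding reciprocity_obstruction_def
    using Psi2_denominator_not_square_and_dvd(1) Psi2_denominator_cong[where t = "0\<^sup>2"]
    by (metis dvd_0_right zero_power2)
qed

end
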